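(* Consider an instance of the problem $1|pmtn; r_j, p_j|F(C_j)$ with integer release times $r_j$, integer processing times $p_j$, and an objective function $F$ that is an increasing function of the completion times. Then in an optimal schedule preemptions occur only at integer points in time; that is, if a job is preempted at time $t$ in an optimal schedule, then $t\in\mathbb{Z}$.
   Context: The problem $1|pmtn; r_j, p_j|F(C_j)$: there are $n$ jobs $1,\dots,n$ to be processed on a single machine, which can process at most one job at each point in time. Job $j$ has an integer release time $r_j\ge 0$ and a positive integer processing time $p_j$. Job $j$ becomes available for processing at the moment $r_j$ (it cannot be processed before time $r_j$) and must be processed for a total time of $p_j$. Preemptions of one job in favor of another are allowed at any (real) time and any (finite) number of times. A schedule specifies which job is processed when: job $j$ is processed on a finite union of intervals of the form $(a,b]$ of real time, and the sets for different jobs are disjoint. It is feasible if no job is processed before its release time and each job $j$ is processed for exactly $p_j$ time. The completion time $C_j$ of job $j$ is the earliest point in time at which it has been processed for $p_j$ time. A preemption at time $t$ means that some job is being processed immediately before $t$, is not yet completed at $t$, and is not being processed immediately after $t$. The objective $F=F(C_1,\dots,C_n)$ is increasing in the completion times: if $C_j\le C_j'$ for all $j$ with strict inequality for at least one $j$, then $F(C_1,\dots,C_n)<F(C_1',\dots,C_n')$. A schedule is optimal if it is feasible and minimizes $F$ among all feasible schedules. Standing assumption: optimal schedules contain no idle time, i.e. with $T=\sum_{j=1}^n p_j$ and time measured from the start of processing, the machine is busy throughout $(0,T]$. *)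

theory Defs
  imports "HOL-Analysis.Analysis"
begin

text \<open>
  The jobs are the elements of a finite type. A schedule assigns to each job the set of times at
  which it is processed; a point \<open>t\<close> of this set stands for processing on an interval
  \<open>(t - \<epsilon>, t]\<close>.
\<close>

type_synonym 'j schedule = "'j \<Rightarrow> real set"

definition finite_interval_union :: "real set \<Rightarrow> bool" where
  "finite_interval_union A \<longleftrightarrow> (\<exists>I. finite I \<and> A = (\<Union>(a, b)\<in>I. {a<..b}))"

definition schedule :: "'j schedule \<Rightarrow> bool" where
  "schedule S \<longleftrightarrow> (\<forall>j. finite_interval_union (S j)) \<and> disjoint_family S"

text \<open>
  The ray of admissible times is open at the release time because an interval \<open>(a, b]\<close> containing
  \<open>r j\<close> would include processing before \<open>r j\<close>.
\<close>

definition feasible :: "('j \<Rightarrow> nat) \<Rightarrow> ('j \<Rightarrow> nat) \<Rightarrow> 'j schedule \<Rightarrow> bool" where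
  "feasible r p S \<longleftrightarrow> schedule S \<and>
     (\<forall>j. S j \<subseteq> {real (r j)<..} \<and> measure lborel (S j) = real (p j))"

definition completion_time :: "('j \<Rightarrow> nat) \<Rightarrow> 'j schedule \<Rightarrow> 'j \<Rightarrow> real" where
  "completion_time p S j = (LEAST t. measure lborel (S j \<inter> {..t}) = real (p j))"

text \<open>
  The order on \<^typ>\<open>'j \<Rightarrow> real\<close> is pointwise, so \<open>C < C'\<close> means \<open>C j \<le> C' j\<close> for all
  \<open>j\<close> with strict inequality for at least one \<open>j\<close>. Monotonicity is required only on vectors that
  are completion times of feasible schedules; this admits, for example, sums of squared flow times
  \<open>(C j - r j)\<^sup>2\<close>.
\<close>

definition increasing_objective ::
  "('j \<Rightarrow> nat) \<Rightarrow> ('j \<Rightarrow> nat) \<Rightarrow> (('j \<Rightarrow> real) \<Rightarrow> real) \<Rightarrow> bool" where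
  "increasing_objective r p F \<longleftrightarrow> strict_mono_on (completion_time p ` {S. feasible r p S}) F"

definition optimal ::
  "('j \<Rightarrow> nat) \<Rightarrow> ('j \<Rightarrow> nat) \<Rightarrow> (('j \<Rightarrow> real) \<Rightarrow> real) \<Rightarrow> 'j schedule \<Rightarrow> bool" where
  "optimal r p F S \<longleftrightarrow> feasible r p S \<and>
     (\<forall>S'. feasible r p S' \<longrightarrow> F (completion_time p S) \<le> F (completion_time p S'))"

text \<open>
  Here \<open>s\<close> is the start of processing; measuring time from the start amounts to \<open>s = 0\<close>.
\<close>

definition no_idle_time :: "('j::finite \<Rightarrow> nat) \<Rightarrow> 'j schedule \<Rightarrow> bool" where
  "no_idle_time p S \<longleftrightarrow> (\<exists>s. {s<..s + real (\<Sum>j\<in>UNIV. p j)} \<subseteq> (\<Union>j. S j))"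

definition preempted_at :: "('j \<Rightarrow> nat) \<Rightarrow> 'j schedule \<Rightarrow> 'j \<Rightarrow> real \<Rightarrow> bool" where
  "preempted_at p S j t \<longleftrightarrow>
     (\<forall>\<^sub>F x in at_left t. x \<in> S j) \<and>
     t < completion_time p S j \<and>
     \<not> (\<forall>\<^sub>F x in at_right t. x \<in> S j)"

end

theory Submission imports Defs begin

text \<open>
  The reason is an exchange of two pieces of equal length \<open>e\<close>. Suppose that job \<open>a\<close> occupies the
  last \<open>e\<close> time units before its completion time, and that an earlier piece \<open>(u, u + e]\<close>, with
  \<open>r a \<le> u\<close>, is idle or belongs to a job \<open>b\<close> that completes after \<open>a\<close>. Give the early piece to
  \<open>a\<close> and, if it belonged to \<open>b\<close>, the late piece to \<open>b\<close>. Then \<open>a\<close> completes strictly earlier,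
  while \<open>b\<close> still completes no later than before, because its new piece lies before its old
  completion time. So no such pair of pieces exists in an optimal schedule
  (\<open>optimal_no_exchange\<close>).

  Now let job \<open>i\<close> be preempted at \<open>t\<close>. The pieces immediately after \<open>t\<close> and immediately before
  \<open>C\<^sub>i\<close> rule out that the machine idles after \<open>t\<close> or that the job \<open>k\<close> processed after \<open>t\<close> completes
  after \<open>i\<close>. Two jobs cannot complete at the same time, so \<open>C\<^sub>k < C\<^sub>i\<close>. Now \<open>i\<close> and \<open>k\<close> change roles: the
  piece of \<open>i\<close> immediately before \<open>t\<close> could be exchanged for the last piece of \<open>k\<close>. The only
  possible obstacle is that \<open>k\<close> is not yet released immediately before \<open>t\<close>. As \<open>k\<close> is processed
  immediately after \<open>t\<close>, this means \<open>r k = t\<close>, and release times are integers.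
\<close>

section \<open>Finite unions of half-open intervals\<close>

lemma finite_interval_union_Un:
  assumes "finite_interval_union A" "finite_interval_union B"
  shows "finite_interval_union (A \<union> B)"
proof -
  obtain I J where "finite I" "A = (\<Union>(a, b)\<in>I. {a<..b})" "finite J" "B = (\<Union>(a, b)\<in>J. {a<..b})"
    using assms unfolding finite_interval_union_def by auto
  then show ?thesis
    unfolding finite_interval_union_def by (intro exI[of _ "I \<union> J"]) auto
qed

lemma finite_interval_union_interval: "finite_interval_union {x<..y}"
  unfolding finite_interval_union_def by (intro exI[of _ "{(x, y)}"]) auto

lemma finite_interval_union_diff_interval:
  assumes "finite_interval_union A" "x \<le> y"
  shows "finite_interval_union (A - {x<..y})"
proof -
  obtain I where I: "finite I" "A = (\<Union>(a, b)\<in>I. {a<..b})"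
    using assms unfolding finite_interval_union_def by auto
  let ?J = "(\<lambda>(a, b). (a, min b x)) ` I \<union> (\<lambda>(a, b). (max a y, b)) ` I"
  have piece: "{a<..b} - {x<..y} = {a<..min b x} \<union> {max a y<..b}" for a b
    using assms(2) by auto
  have "A - {x<..y} = (\<Union>(a, b)\<in>I. {a<..b} - {x<..y})"
    unfolding I(2) by blast
  also have "\<dots> = (\<Union>(a, b)\<in>?J. {a<..b})"
    unfolding piece by (simp add: case_prod_beta UN_Un_distrib)
  finally show ?thesis
    unfolding finite_interval_union_def using I(1) by (intro exI[of _ ?J]) simp
qed

lemma finite_interval_union_fmeasurable:
  assumes "finite_interval_union A"
  shows "A \<in> fmeasurable lborel"
proof -
  obtain I where I: "finite I" "A = (\<Union>(a, b)\<in>I. {a<..b})"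
    using assms unfolding finite_interval_union_def by auto
  have "{a<..b} \<in> fmeasurable lborel" for a b :: real
    by (cases "a \<le> b") (auto intro!: fmeasurableI)
  then show ?thesis
    unfolding I(2) by (intro fmeasurable.finite_UN[OF I(1)]) auto
qed

text \<open>
  Near a point, on either side, such a set is all or nothing; this lets the exchange argument work
  with whole pieces.
\<close>

lemma eventually_interval_right_inside_or_outside:
  assumes "finite_interval_union A"
  shows "\<forall>\<^sub>F e in at_right 0. {t<..t + e} \<subseteq> A \<or> {t<..t + e} \<inter> A = {}"
proof -
  obtain I where I: "finite I" "A = (\<Union>(a, b)\<in>I. {a<..b})"
    using assms unfolding finite_interval_union_def by auto
  have piece: "\<forall>\<^sub>F e in at_right 0. {t<..t + e} \<subseteq> {a<..b} \<or> {t<..t + e} \<inter> {a<..b} = {}"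
    for a b :: real
  proof -
    consider "t < a" | "a \<le> t" "t < b" | "b \<le> t" by linarith
    then show ?thesis
    proof cases
      case 1
      then show ?thesis
        unfolding eventually_at_right_field by (intro exI[of _ "a - t"]) auto
    next
      case 2
      then show ?thesis
        unfolding eventually_at_right_field by (intro exI[of _ "b - t"]) auto
    qed auto
  qed
  have "\<forall>\<^sub>F e in at_right 0. \<forall>(a, b)\<in>I. {t<..t + e} \<subseteq> {a<..b} \<or> {t<..t + e} \<inter> {a<..b} = {}"
    using piece by (intro eventually_ball_finite I(1)) auto
  then show ?thesis
    unfolding I(2) by eventually_elim blast
qed

lemma eventually_interval_left_inside_or_outside:
  assumes "finite_interval_union A"
  shows "\<forall>\<^sub>F e in at_right 0. {t - e<..t} \<subseteq> A \<or> {t - e<..t} \<inter> A = {}"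
proof -
  obtain I where I: "finite I" "A = (\<Union>(a, b)\<in>I. {a<..b})"
    using assms unfolding finite_interval_union_def by auto
  have piece: "\<forall>\<^sub>F e in at_right 0. {t - e<..t} \<subseteq> {a<..b} \<or> {t - e<..t} \<inter> {a<..b} = {}"
    for a b :: real
  proof -
    consider "t \<le> a" | "a < t" "t \<le> b" | "b < t" by linarith
    then show ?thesis
    proof cases
      case 2
      then show ?thesis
        unfolding eventually_at_right_field by (intro exI[of _ "t - a"]) auto
    next
      case 3
      then show ?thesis
        unfolding eventually_at_right_field by (intro exI[of _ "t - b"]) auto
    qed auto
  qed
  have "\<forall>\<^sub>F e in at_right 0. \<forall>(a, b)\<in>I. {t - e<..t} \<subseteq> {a<..b} \<or> {t - e<..t} \<inter> {a<..b} = {}"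
    using piece by (intro eventually_ball_finite I(1)) auto
  then show ?thesis
    unfolding I(2) by eventually_elim blast
qed

lemma eventually_interval_left_inside:
  assumes "finite_interval_union A" "t \<in> A"
  shows "\<forall>\<^sub>F e in at_right 0. {t - e<..t} \<subseteq> A"
  using eventually_interval_left_inside_or_outside[OF assms(1), of t] eventually_at_right_less[of 0]
proof eventually_elim
  case (elim e)
  then have "t \<in> {t - e<..t}" by simp
  with elim(1) assms(2) show ?case by blast
qed

lemma eventually_two_pieces_fit:
  fixes y :: real
  assumes "0 < y"
  shows "\<forall>\<^sub>F e in at_right 0. 2 * e < y"
  unfolding eventually_at_right_field using assms by (intro exI[of _ "y / 2"]) auto

lemma finite_interval_union_greatest:
  assumes "finite_interval_union A" "A \<noteq> {}"
  obtains M where "M \<in> A" "A \<subseteq> {..M}"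
proof -
  obtain I where I: "finite I" "A = (\<Union>(a, b)\<in>I. {a<..b})"
    using assms unfolding finite_interval_union_def by auto
  let ?B = "snd ` {(a, b)\<in>I. a < b}"
  have fin: "finite ?B"
    using I(1) by (auto intro: finite_subset[OF _ finite_imageI])
  have "?B \<noteq> {}"
    using assms(2) unfolding I(2) by fastforce
  then have "Max ?B \<in> ?B"
    using fin by (rule Max_in[rotated])
  then have "Max ?B \<in> A"
    unfolding I(2) by force
  moreover have "x \<le> Max ?B" if "x \<in> A" for x
  proof -
    obtain a b where "(a, b) \<in> I" "a < x" "x \<le> b"
      using \<open>x \<in> A\<close> unfolding I(2) by auto
    then have "b \<in> ?B" by force
    then show ?thesis
      using Max_ge[OF fin] \<open>x \<le> b\<close> by fastforce
  qed
  ultimately show thesis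
    by (intro that[of "Max ?B"]) auto
qed

section \<open>Completion times\<close>

text \<open>
  The last point of the processing set is the earliest time with full processing: stopping at any
  earlier time loses a left neighbourhood of that point, which has positive measure.
\<close>

lemma completion_time_greatest:
  assumes "feasible r p S" "0 < p j"
  shows "completion_time p S j \<in> S j" "S j \<subseteq> {..completion_time p S j}"
proof -
  have fiu: "finite_interval_union (S j)" and m: "measure lborel (S j) = real (p j)"
    using assms(1) unfolding feasible_def schedule_def by auto
  have "S j \<noteq> {}" using m assms(2) by auto
  then obtain M where M: "M \<in> S j" "S j \<subseteq> {..M}"
    using finite_interval_union_greatest[OF fiu] by blast
  have "completion_time p S j = M"
    unfolding completion_time_def
  proof (rule Least_equality)
    show "measure lborel (S j \<inter> {..M}) = real (p j)"
      using M(2) m by (simp add: Int_absorb2)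
  next
    fix s assume s: "measure lborel (S j \<inter> {..s}) = real (p j)"
    show "M \<le> s"
    proof (rule ccontr)
      assume "\<not> M \<le> s"
      then have "\<forall>\<^sub>F e in at_right 0. 2 * e < M - s"
        by (intro eventually_two_pieces_fit) simp
      with eventually_interval_left_inside[OF fiu M(1)] eventually_at_right_less[of 0]
      have "\<forall>\<^sub>F e in at_right 0. {M - e<..M} \<subseteq> S j \<and> 0 < e \<and> e < M - s"
        by eventually_elim simp
      then obtain e where e: "{M - e<..M} \<subseteq> S j" "0 < e" "e < M - s"
        using eventually_happens'[OF trivial_limit_at_right_real] by blast
      have fm: "S j \<in> fmeasurable lborel" "{M - e<..M} \<in> fmeasurable lborel"
        using fiu by (auto intro: finite_interval_union_fmeasurable finite_interval_union_interval)
      have "measure lborel (S j \<inter> {..s}) \<le> measure lborel (S j - {M - e<..M})"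
        using e fm by (intro measure_mono_fmeasurable fmeasurable.Diff) (auto simp: fmeasurableD)
      also have "\<dots> = measure lborel (S j) - e"
        using e fm by (simp add: measurable_measure_Diff fmeasurableD)
      finally show False using s m e(2) by simp
    qed
  qed
  with M show "completion_time p S j \<in> S j" "S j \<subseteq> {..completion_time p S j}"
    by simp_all
qed

lemma completion_time_inj:
  assumes "feasible r p S" "\<And>j. 0 < p j" "j \<noteq> k"
  shows "completion_time p S j \<noteq> completion_time p S k"
proof -
  have "S j \<inter> S k = {}"
    using assms(1,3) unfolding feasible_def schedule_def disjoint_family_on_def by blast
  then show ?thesis
    using completion_time_greatest(1)[OF assms(1,2), of j]
      completion_time_greatest(1)[OF assms(1,2), of k] by auto
qed

section \<open>The exchange argument\<close>

lemma measure_replace_interval: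
  assumes "finite_interval_union A" "{x<..x + e} \<subseteq> A" "{y<..y + e} \<inter> A = {}" "0 \<le> e"
  shows "measure lborel (A - {x<..x + e} \<union> {y<..y + e}) = measure lborel A"
proof -
  have fm: "A \<in> fmeasurable lborel" "{x<..x + e} \<in> fmeasurable lborel"
    "{y<..y + e} \<in> fmeasurable lborel"
    using assms(1) by (auto intro: finite_interval_union_fmeasurable finite_interval_union_interval)
  have "measure lborel (A - {x<..x + e} \<union> {y<..y + e})
      = measure lborel (A - {x<..x + e}) + measure lborel {y<..y + e}"
    using fm assms(3) by (intro measure_Un3[THEN trans]) (auto simp: Diff_Int_distrib Int_commute)
  then show ?thesis
    using fm assms by (simp add: measurable_measure_Diff fmeasurableD)
qed

text \<open>
  The hypothesis on \<open>{u<..u + e}\<close> covers an idle piece and a piece of a job that completes after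
  \<open>a\<close> at once; it also excludes that the piece belongs to \<open>a\<close> itself.
\<close>

lemma optimal_no_exchange:
  fixes r p :: "'j::finite \<Rightarrow> nat"
  assumes pos: "\<And>j. 0 < p j"
    and inc: "increasing_objective r p F"
    and opt: "optimal r p F S"
    and e: "0 < e"
    and early: "\<And>j. {u<..u + e} \<inter> S j = {} \<or>
          {u<..u + e} \<subseteq> S j \<and> completion_time p S a < completion_time p S j"
    and late: "{completion_time p S a - e<..completion_time p S a} \<subseteq> S a"
    and apart: "u + e \<le> completion_time p S a - e"
    and released: "real (r a) \<le> u"
  shows False
proof -
  define D where "D = {u<..u + e}"
  define c where "c = completion_time p S a - e"
  define E where "E = {c<..c + e}"
  define S' where "S' j =
    (if j = a then S a - E \<union> D else if D \<inter> S j = {} then S j else S j - D \<union> E)" for j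
  have feas: "feasible r p S" using opt unfolding optimal_def by simp
  then have fiu: "finite_interval_union (S j)" and m: "measure lborel (S j) = real (p j)"
    and rel: "S j \<subseteq> {real (r j)<..}" and disj: "disjoint_family S" for j
    unfolding feasible_def schedule_def by auto
  have disjD: "S j \<inter> S k = {}" if "j \<noteq> k" for j k
    using disj that unfolding disjoint_family_on_def by simp
  have D: "D \<inter> S j = {} \<or> D \<subseteq> S j \<and> completion_time p S a < completion_time p S j" for j
    using early unfolding D_def by simp
  have E: "E \<subseteq> S a" using late unfolding E_def c_def by simp
  have DE: "D \<inter> E = {}" using apart unfolding D_def E_def c_def by auto
  have Dne: "u + e \<in> D" using e unfolding D_def by simp
  have Da: "D \<inter> S a = {}" using D[of a] by auto
  have Sj_E: "S j \<inter> E = {}" if "j \<noteq> a" for j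
    using E disjD[OF that] by blast
  have "finite_interval_union (S' j)" for j
    unfolding S'_def D_def E_def using fiu e
    by (auto intro!: finite_interval_union_Un finite_interval_union_interval
        finite_interval_union_diff_interval)
  moreover have "S' j \<inter> S' k = {}" if "j \<noteq> k" for j k
  proof -
    \<comment> \<open>By symmetry, \<open>k\<close> may be taken to be a job other than \<open>a\<close>.\<close>
    have "S' j \<inter> S' k = {}" if "j \<noteq> k" "k \<noteq> a" for j k
      using that disjD[of j k] Sj_E[of j] Sj_E[of k] D[of j] D[of k] Da DE Dne E
      unfolding S'_def by (auto split: if_splits)
    then show ?thesis using that by (metis Int_commute)
  qed
  moreover have "S' j \<subseteq> {real (r j)<..}" for j
  proof -
    have "D \<subseteq> {real (r a)<..}" using released unfolding D_def by auto
    moreover have "E \<subseteq> {real (r j)<..}" if "D \<subseteq> S j"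
    proof -
      have "real (r j) < u + e" using rel[of j] that Dne by auto
      then show ?thesis using apart unfolding E_def c_def by auto
    qed
    ultimately show ?thesis using rel[of j] D[of j] unfolding S'_def by auto
  qed
  moreover have "measure lborel (S' j) = real (p j)" for j
  proof -
    have "measure lborel (S a - E \<union> D) = real (p a)"
      using measure_replace_interval[OF fiu, of c e a u] E Da e m unfolding D_def E_def by simp
    moreover have "measure lborel (S j - D \<union> E) = real (p j)" if "D \<subseteq> S j" "j \<noteq> a"
      using measure_replace_interval[OF fiu, of u e j c] that Sj_E[of j] e m
      unfolding D_def E_def by (simp add: Int_commute)
    ultimately show ?thesis using D[of j] m unfolding S'_def by auto
  qed
  ultimately have feas': "feasible r p S'"
    unfolding feasible_def schedule_def disjoint_family_on_def by simp
  have "completion_time p S' a < completion_time p S a"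
  proof -
    have "S' a \<subseteq> {..c}"
      using completion_time_greatest(2)[OF feas pos, of a] apart e
      unfolding S'_def E_def D_def c_def by auto
    then show ?thesis
      using completion_time_greatest(1)[OF feas' pos, of a] e unfolding c_def by force
  qed
  moreover have "completion_time p S' j \<le> completion_time p S j" if "j \<noteq> a" for j
  proof -
    have "S' j \<subseteq> {..completion_time p S j}"
      using completion_time_greatest(2)[OF feas pos, of j] D[of j] that
      unfolding S'_def E_def c_def by auto
    then show ?thesis
      using completion_time_greatest(1)[OF feas' pos, of j] by blast
  qed
  ultimately have "completion_time p S' < completion_time p S"
    unfolding less_fun_def le_fun_def by (metis less_imp_le not_le)
  then have "F (completion_time p S') < F (completion_time p S)"
    using inc feas feas' unfolding increasing_objective_def strict_mono_on_def by blast
  then show False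
    using opt feas' unfolding optimal_def by (meson not_le)
qed

theorem theorem1:
  fixes r p :: "'j::finite \<Rightarrow> nat"
    and F :: "('j \<Rightarrow> real) \<Rightarrow> real"
  assumes "\<And>j. 0 < p j"
    and "increasing_objective r p F"
    and "\<And>S. optimal r p F S \<Longrightarrow> no_idle_time p S"
    and "optimal r p F S"
    and "preempted_at p S j t"
  shows "t \<in> \<int>"
proof (rule ccontr)
  assume nonint: "t \<notin> \<int>"
  let ?C = "completion_time p S"
  have feas: "feasible r p S" using assms(4) unfolding optimal_def by simp
  then have fiu: "finite_interval_union (S k)" and rel: "S k \<subseteq> {real (r k)<..}" for k
    unfolding feasible_def schedule_def by auto
  have disjD: "S k \<inter> S l = {}" if "k \<noteq> l" for k l
    using feas that unfolding feasible_def schedule_def disjoint_family_on_def by simp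
  have before: "\<forall>\<^sub>F x in at_left t. x \<in> S j" and tC: "t < ?C j"
    and after: "\<not> (\<forall>\<^sub>F x in at_right t. x \<in> S j)"
    using assms(5) unfolding preempted_at_def by auto
  \<comment> \<open>One length \<open>e\<close> serves both exchanges. The factor 2 leaves room for two disjoint pieces between
    \<open>t\<close> and a later completion time.\<close>
  have two_pieces: "\<forall>\<^sub>F e in at_right 0. 0 < y \<longrightarrow> 2 * e < y" for y :: real
    using eventually_two_pieces_fit[of y] by (cases "0 < y") simp_all
  have "\<forall>\<^sub>F e in at_right 0. 0 < e \<and>
    (\<forall>k. {t<..t + e} \<subseteq> S k \<or> {t<..t + e} \<inter> S k = {}) \<and>
    ({t - e<..t} \<subseteq> S j \<or> {t - e<..t} \<inter> S j = {}) \<and>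
    (\<forall>k. {?C k - e<..?C k} \<subseteq> S k) \<and>
    (\<forall>k. 0 < ?C k - t \<longrightarrow> 2 * e < ?C k - t) \<and>
    (\<forall>k. 0 < t - real (r k) \<longrightarrow> 2 * e < t - real (r k))"
    by (intro eventually_conj eventually_all_finite eventually_at_right_less two_pieces
        eventually_interval_right_inside_or_outside eventually_interval_left_inside_or_outside
        eventually_interval_left_inside completion_time_greatest(1)[OF feas] fiu assms(1))
  then obtain e where e: "0 < e"
    and right: "\<And>k. {t<..t + e} \<subseteq> S k \<or> {t<..t + e} \<inter> S k = {}"
    and left: "{t - e<..t} \<subseteq> S j \<or> {t - e<..t} \<inter> S j = {}"
    and last: "\<And>k. {?C k - e<..?C k} \<subseteq> S k"
    and eC: "\<And>k. t < ?C k \<Longrightarrow> 2 * e < ?C k - t"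
    and er: "\<And>k. real (r k) < t \<Longrightarrow> 2 * e < t - real (r k)"
    using eventually_happens'[OF trivial_limit_at_right_real, of _ 0] by (smt (verit, best))
  have left_j: "{t - e<..t} \<subseteq> S j"
  proof -
    have "\<forall>\<^sub>F x in at_left t. x \<in> {t - e<..<t}"
      using e by (intro eventually_at_left_real) simp
    with before have "\<forall>\<^sub>F x in at_left t. x \<in> S j \<and> x \<in> {t - e<..t}"
      by eventually_elim auto
    then obtain x where "x \<in> S j" "x \<in> {t - e<..t}"
      using eventually_happens'[OF trivial_limit_at_left_real] by blast
    then show ?thesis using left by blast
  qed
  have right_j: "{t<..t + e} \<inter> S j = {}"
  proof (rule ccontr)
    assume "{t<..t + e} \<inter> S j \<noteq> {}"
    then have sub: "{t<..t + e} \<subseteq> S j" using right by blast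
    have "\<forall>\<^sub>F x in at_right t. x \<in> {t<..<t + e}"
      using e by (intro eventually_at_right_real) simp
    then have "\<forall>\<^sub>F x in at_right t. x \<in> S j"
      by eventually_elim (use sub in auto)
    then show False using after by blast
  qed
  have "t \<in> S j" using left_j e by auto
  show False
  proof (cases "\<exists>k. {t<..t + e} \<subseteq> S k \<and> ?C k < ?C j")
    case False
    \<comment> \<open>The piece after \<open>t\<close> is exchanged for the last piece of \<open>j\<close>.\<close>
    have "{t<..t + e} \<inter> S k = {} \<or> {t<..t + e} \<subseteq> S k \<and> ?C j < ?C k" for k
    proof (cases "k = j")
      case True
      then show ?thesis using right_j by simp
    next
      case other: False
      then have "?C k \<noteq> ?C j" by (rule completion_time_inj[OF feas assms(1)])
      then show ?thesis using False right[of k] by force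
    qed
    moreover have "real (r j) \<le> t" using rel[of j] \<open>t \<in> S j\<close> by auto
    ultimately show False
      using eC[OF tC] last[of j]
      by (intro optimal_no_exchange[OF assms(1,2,4) e, of t j]) auto
  next
    case True
    \<comment> \<open>The piece of \<open>j\<close> before \<open>t\<close> is exchanged for the last piece of \<open>k\<close>.\<close>
    then obtain k where k: "{t<..t + e} \<subseteq> S k" and Ckj: "?C k < ?C j" by blast
    have "t + e \<in> S k" using k e by auto
    then have "t < ?C k"
      using completion_time_greatest(2)[OF feas assms(1), of k] e by auto
    have "real (r k) < t"
    proof -
      have "real (r k) \<le> t"
      proof (rule ccontr)
        assume "\<not> real (r k) \<le> t"
        \<comment> \<open>This point of the piece after \<open>t\<close> does not lie after the release of \<open>k\<close>.\<close>
        then have "min (t + e) (real (r k)) \<in> S k" using k e by auto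
        then show False using rel[of k] by auto
      qed
      moreover have "real (r k) \<noteq> t" using nonint by auto
      ultimately show ?thesis by simp
    qed
    moreover have "{t - e<..t - e + e} \<inter> S l = {} \<or>
        {t - e<..t - e + e} \<subseteq> S l \<and> ?C k < ?C l" for l
      using left_j Ckj disjD[of j l] by (cases "l = j") auto
    ultimately show False
      using er[of k] eC[OF \<open>t < ?C k\<close>] last[of k] e
      by (intro optimal_no_exchange[OF assms(1,2,4) e, of "t - e" k]) auto
  qed
qed

end
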